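(* Let $X_1,X_2,\dots$ be i.i.d. random elements of a measurable space $\mathcal X$. Let $(\Theta,d)$ be a metric space and $G$ a finite group acting on $\Theta$ by bijective isometries. Let $K\subset\Theta$ be nonempty, compact, and satisfy $gK=K$ for all $g\in G$. Let $\ell:\Theta\times\mathcal X\to\mathbb{R}$ be jointly measurable and put $$Q_n(\theta)=\frac1n\sum_{i=1}^n\ell(\theta,X_i),\qquad Q(\theta)=\mathbb{E}[\ell(\theta,X_1)],$$ the expectations being assumed to exist. Assume: (1) for all $g\in G$, $\theta\in K$: $Q(g\theta)=Q(\theta)$, and for each $n$, $Q_n(g\theta)=Q_n(\theta)$ almost surely; (2) with $Q_0:=\arg\max_{\theta\in K}Q(\theta)$, for every $\varepsilon>0$ there exists $\eta(\varepsilon)>0$ such that $$\sup_{\theta\in K:\ d_G(\theta,Q_0)\ge\varepsilon}Q(\theta)\le\sup_{\theta\in Q_0}Q(\theta)-\eta(\varepsilon);$$ (3) $\sup_{\theta\in K}|Q_n(\theta)-Q(\theta)|\to0$ in probability. Let $\hat\theta_n\in K$ be a (possibly random) sequence satisfying $$Q_n(\hat\theta_n)\ge\sup_{\theta\in K}Q_n(\theta)-r_n,\qquad r_n\to0\ \text{in probability.}$$ Then $d_G(\hat\theta_n,Q_0)\to0$ in probability; equivalently, $\bar d([\hat\theta_n],\{[\theta]:\theta\in Q_0\})\to0$ in probability.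
   Context: $[\theta]=\{g\theta:g\in G\}$ is the orbit of $\theta$; $d_G(\theta,\theta')=\min_{g\in G}d(\theta,g\theta')$; $d_G(\theta,A)=\inf_{a\in A}d_G(\theta,a)$; $\bar d([\theta],[\theta'])=d_G(\theta,\theta')$ is the induced metric on the orbit space $\Theta/G$, and the $\bar d$-distance from a point to a set is the infimum of distances. The supremum over the empty set is $-\infty$. *)

theory Defs
  imports "HOL-Probability.Probability" "HOL-Algebra.Group_Action"
begin

text \<open>
  Suprema and infima are taken in \<^typ>\<open>ereal\<close>, so that the supremum of the empty set is
  \<open>-\<infinity>\<close>, the distance to the empty set is \<open>\<infinity>\<close>, and the supremum of an unbounded family of
  reals is \<open>\<infinity>\<close>.
\<close>

definition isometric_action ::
    "('g, 'm) monoid_scheme \<Rightarrow> ('g \<Rightarrow> 'a \<Rightarrow> 'a::metric_space) \<Rightarrow> bool" where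
  "isometric_action G \<phi> \<longleftrightarrow>
     group_action G UNIV \<phi> \<and> (\<forall>g\<in>carrier G. \<forall>x y. dist (\<phi> g x) (\<phi> g y) = dist x y)"

definition dG :: "('g, 'm) monoid_scheme \<Rightarrow> ('g \<Rightarrow> 'a \<Rightarrow> 'a::metric_space) \<Rightarrow> 'a \<Rightarrow> 'a \<Rightarrow> real" where
  "dG G \<phi> \<theta> \<theta>' = Min ((\<lambda>g. dist \<theta> (\<phi> g \<theta>')) ` carrier G)"

definition dG_set ::
    "('g, 'm) monoid_scheme \<Rightarrow> ('g \<Rightarrow> 'a \<Rightarrow> 'a::metric_space) \<Rightarrow> 'a \<Rightarrow> 'a set \<Rightarrow> ereal" where
  "dG_set G \<phi> \<theta> A = (INF a\<in>A. ereal (dG G \<phi> \<theta> a))"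

text \<open>
  The induced metric on orbits is computed on arbitrary representatives; lemma \<open>orbit_dist_orbit\<close>
  below shows that the choice does not matter.
\<close>

definition orbit_dist ::
    "('g, 'm) monoid_scheme \<Rightarrow> ('g \<Rightarrow> 'a \<Rightarrow> 'a::metric_space) \<Rightarrow> 'a set \<Rightarrow> 'a set \<Rightarrow> real" where
  "orbit_dist G \<phi> A B = dG G \<phi> (SOME \<theta>. \<theta> \<in> A) (SOME \<theta>'. \<theta>' \<in> B)"

definition orbit_dist_set ::
    "('g, 'm) monoid_scheme \<Rightarrow> ('g \<Rightarrow> 'a \<Rightarrow> 'a::metric_space) \<Rightarrow> 'a set \<Rightarrow> 'a set set \<Rightarrow> ereal" where
  "orbit_dist_set G \<phi> A \<C> = (INF B\<in>\<C>. ereal (orbit_dist G \<phi> A B))"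

definition iid_seq :: "'w measure \<Rightarrow> 'x measure \<Rightarrow> (nat \<Rightarrow> 'w \<Rightarrow> 'x) \<Rightarrow> bool" where
  "iid_seq M S X \<longleftrightarrow>
     prob_space.indep_vars M (\<lambda>_. S) X {1..} \<and> (\<forall>i\<ge>1. distr M S (X i) = distr M S (X 1))"

definition emp_crit ::
    "('a \<Rightarrow> 'x \<Rightarrow> real) \<Rightarrow> (nat \<Rightarrow> 'w \<Rightarrow> 'x) \<Rightarrow> nat \<Rightarrow> 'a \<Rightarrow> 'w \<Rightarrow> real" where
  "emp_crit l X n \<theta> \<omega> = (1 / real n) * (\<Sum>i=1..n. l \<theta> (X i \<omega>))"

definition pop_crit ::
    "'w measure \<Rightarrow> ('a \<Rightarrow> 'x \<Rightarrow> real) \<Rightarrow> (nat \<Rightarrow> 'w \<Rightarrow> 'x) \<Rightarrow> 'a \<Rightarrow> real" where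
  "pop_crit M l X \<theta> = prob_space.expectation M (\<lambda>\<omega>. l \<theta> (X 1 \<omega>))"

definition argmax_on :: "('a \<Rightarrow> real) \<Rightarrow> 'a set \<Rightarrow> 'a set" where
  "argmax_on f K = {\<theta>. is_arg_max f (\<lambda>\<theta>. \<theta> \<in> K) \<theta>}"

text \<open>
  Convergence to 0 in probability.  Suprema over uncountable sets and approximate maximisers need
  not be measurable, hence the outer measure; for measurable sequences this is the usual notion
  (lemma \<open>tendsto0_in_prob_measurable\<close>).
\<close>

definition tendsto0_in_prob :: "'w measure \<Rightarrow> (nat \<Rightarrow> 'w \<Rightarrow> ereal) \<Rightarrow> bool" where
  "tendsto0_in_prob M Y \<longleftrightarrow>
     (\<forall>\<epsilon>>0. (\<lambda>n. outer_measure_of M {\<omega> \<in> space M. ereal \<epsilon> < \<bar>Y n \<omega>\<bar>}) \<longlonglongrightarrow> 0)"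

lemma tendsto0_in_prob_measurable:
  assumes "prob_space M" and [measurable]: "\<And>n. Y n \<in> borel_measurable M"
  shows "tendsto0_in_prob M (\<lambda>n \<omega>. ereal (Y n \<omega>)) \<longleftrightarrow>
    (\<forall>\<epsilon>>0. (\<lambda>n. measure M {\<omega> \<in> space M. \<epsilon> < \<bar>Y n \<omega>\<bar>}) \<longlonglongrightarrow> 0)"
proof -
  interpret prob_space M by fact
  show ?thesis
    by (simp add: tendsto0_in_prob_def emeasure_eq_measure flip: ennreal_0)
qed

lemma orbit_dist_orbit:
  assumes "isometric_action G \<phi>"
  shows "orbit_dist G \<phi> (orbit G \<phi> \<theta>) (orbit G \<phi> \<theta>') = dG G \<phi> \<theta> \<theta>'"
proof -
  interpret group_action G UNIV \<phi>
    using assms by (simp add: isometric_action_def)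
  interpret group G
    using group_hom group_hom.axioms(1) by blast
  have iso: "dist (\<phi> g x) (\<phi> g y) = dist x y" if "g \<in> carrier G" for g x y
    using assms that by (simp add: isometric_action_def)
  have comp: "\<phi> (g \<otimes>\<^bsub>G\<^esub> h) x = \<phi> g (\<phi> h x)" if "g \<in> carrier G" "h \<in> carrier G" for g h x
    using composition_rule[of x g h] that by simp
  have sub: "(\<lambda>g. dist a (\<phi> g b)) ` carrier G \<subseteq> (\<lambda>g. dist x (\<phi> g y)) ` carrier G"
    if ab: "a \<in> orbit G \<phi> x" "b \<in> orbit G \<phi> y" for a b x y
  proof
    fix r assume "r \<in> (\<lambda>g. dist a (\<phi> g b)) ` carrier G"
    then obtain g where g: "g \<in> carrier G" "r = dist a (\<phi> g b)" by auto
    obtain h k where h: "h \<in> carrier G" "a = \<phi> h x" and k: "k \<in> carrier G" "b = \<phi> k y"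
      using ab by (auto simp: orbit_def)
    let ?m = "inv\<^bsub>G\<^esub> h \<otimes>\<^bsub>G\<^esub> (g \<otimes>\<^bsub>G\<^esub> k)"
    have m: "?m \<in> carrier G" using g h k by simp
    have "h \<otimes>\<^bsub>G\<^esub> ?m = g \<otimes>\<^bsub>G\<^esub> k"
      using g h k by (simp flip: m_assoc)
    then have "\<phi> h (\<phi> ?m y) = \<phi> g b"
      using comp[OF h(1) m, of y] comp[OF g(1) k(1), of y] k by simp
    then have "r = dist x (\<phi> ?m y)"
      using iso[OF h(1), of x "\<phi> ?m y"] g h by simp
    with m show "r \<in> (\<lambda>g. dist x (\<phi> g y)) ` carrier G" by blast
  qed
  define a b where "a = (SOME a. a \<in> orbit G \<phi> \<theta>)" and "b = (SOME b. b \<in> orbit G \<phi> \<theta>')"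
  have ab: "a \<in> orbit G \<phi> \<theta>" "b \<in> orbit G \<phi> \<theta>'"
    unfolding a_def b_def by (rule someI, rule orbit_refl, simp)+
  then have "\<theta> \<in> orbit G \<phi> a" "\<theta>' \<in> orbit G \<phi> b"
    by (auto intro: orbit_sym)
  with ab sub show ?thesis
    unfolding orbit_dist_def dG_def a_def[symmetric] b_def[symmetric]
    by (metis subset_antisym)
qed

end

theory Submission
  imports Defs
begin

text \<open>
  If \<open>\<theta>hat\<close> is \<open>\<epsilon>\<close>-far from \<open>Q0\<close>, separation costs it at least \<open>\<eta>\<close> in \<open>Q\<close>, whereas near-maximality
  gives \<open>Q \<theta>hat \<ge> max Q - 2 D - r\<close>, where \<open>D\<close> is the uniform deviation of \<open>Qn\<close> from \<open>Q\<close>.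
  So \<open>\<eta> \<le> 2 D + r\<close>, and \<open>D\<close> or \<open>\<bar>r\<bar>\<close> exceeds \<open>\<eta> / 4\<close>, an event of vanishing outer probability.
\<close>

text \<open>Each set has a measurable hull of the same outer measure, so the bound reduces to
  subadditivity of the measure on the two hulls.\<close>

lemma outer_measure_of_Un_le:
  assumes "A \<subseteq> space M" "B \<subseteq> space M"
  shows "outer_measure_of M (A \<union> B) \<le> outer_measure_of M A + outer_measure_of M B"
proof -
  obtain A' B' where A': "A' \<in> sets M" "A \<subseteq> A'" "outer_measure_of M A = emeasure M A'"
    and B': "B' \<in> sets M" "B \<subseteq> B'" "outer_measure_of M B = emeasure M B'"
    using outer_measure_of_attain[OF assms(1)] outer_measure_of_attain[OF assms(2)] by blast
  have "outer_measure_of M (A \<union> B) \<le> outer_measure_of M (A' \<union> B')"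
    using A' B' by (intro outer_measure_of_mono) auto
  also have "\<dots> = emeasure M (A' \<union> B')"
    using A' B' by (intro outer_measure_of_eq) simp
  also have "\<dots> \<le> emeasure M A' + emeasure M B'"
    using A' B' by (intro emeasure_subadditive)
  finally show ?thesis using A' B' by simp
qed

text \<open>The exceptional set lies in a measurable null set \<open>N\<close>, so \<open>A\<close>
  is contained in \<open>N \<union> B\<close>, and \<open>N\<close> adds nothing to the outer
  measure.\<close>

lemma outer_measure_of_AE_mono:
  assumes "AE \<omega> in M. \<omega> \<in> A \<longrightarrow> \<omega> \<in> B" and "A \<subseteq> space M" "B \<subseteq> space M"
  shows "outer_measure_of M A \<le> outer_measure_of M B"
proof -
  obtain N where N: "{\<omega> \<in> space M. \<not> (\<omega> \<in> A \<longrightarrow> \<omega> \<in> B)} \<subseteq> N" "emeasure M N = 0" "N \<in> sets M"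
    using assms(1) by (rule AE_E)
  have "outer_measure_of M A \<le> outer_measure_of M (N \<union> B)"
    using N assms(2) by (intro outer_measure_of_mono) auto
  also have "\<dots> \<le> outer_measure_of M N + outer_measure_of M B"
    using sets.sets_into_space[OF N(3)] assms(3) by (rule outer_measure_of_Un_le)
  finally show ?thesis using N by simp
qed

text \<open>This turns convergence in probability into a pointwise argument, without measurability
  of the sequences. The threshold \<delta> must be uniform in \<open>n\<close>; the index 0, an
  empty sample in the application, does not affect the limit.\<close>

lemma tendsto0_in_prob_dominated:
  assumes Y: "tendsto0_in_prob M Y" and Z: "tendsto0_in_prob M Z"
    and dom: "\<And>\<epsilon>::real. \<epsilon> > 0 \<Longrightarrow> \<exists>\<delta>>0::real. \<forall>n\<ge>1. AE \<omega> in M.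
      ereal \<epsilon> < \<bar>W n \<omega>\<bar> \<longrightarrow> ereal \<delta> < \<bar>Y n \<omega>\<bar> \<or> ereal \<delta> < \<bar>Z n \<omega>\<bar>"
  shows "tendsto0_in_prob M W"
  unfolding tendsto0_in_prob_def
proof (intro allI impI)
  fix \<epsilon> :: real assume "\<epsilon> > 0"
  then obtain \<delta> :: real where \<delta>: "\<delta> > 0" and ae: "\<And>n. n \<ge> 1 \<Longrightarrow> AE \<omega> in M.
      ereal \<epsilon> < \<bar>W n \<omega>\<bar> \<longrightarrow> ereal \<delta> < \<bar>Y n \<omega>\<bar> \<or> ereal \<delta> < \<bar>Z n \<omega>\<bar>"
    using dom by meson
  let ?\<mu> = "\<lambda>V e n. outer_measure_of M {\<omega> \<in> space M. ereal e < \<bar>V n \<omega>\<bar>}"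
  have "?\<mu> W \<epsilon> n \<le> ?\<mu> Y \<delta> n + ?\<mu> Z \<delta> n" if "n \<ge> 1" for n
  proof -
    have "AE \<omega> in M. \<omega> \<in> {\<omega> \<in> space M. ereal \<epsilon> < \<bar>W n \<omega>\<bar>} \<longrightarrow>
        \<omega> \<in> {\<omega> \<in> space M. ereal \<delta> < \<bar>Y n \<omega>\<bar>} \<union> {\<omega> \<in> space M. ereal \<delta> < \<bar>Z n \<omega>\<bar>}"
      using ae[OF that] by (auto elim: AE_mp)
    from outer_measure_of_AE_mono[OF this] show ?thesis
      by (rule order_trans) (auto intro: outer_measure_of_Un_le)
  qed
  then have "eventually (\<lambda>n. ?\<mu> W \<epsilon> n \<le> ?\<mu> Y \<delta> n + ?\<mu> Z \<delta> n) sequentially"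
    using eventually_sequentially by blast
  moreover have "(\<lambda>n. ?\<mu> Y \<delta> n + ?\<mu> Z \<delta> n) \<longlonglongrightarrow> 0 + 0"
    using Y Z \<delta> by (intro tendsto_add) (auto simp: tendsto0_in_prob_def)
  ultimately show "?\<mu> W \<epsilon> \<longlonglongrightarrow> 0"
    by (intro tendsto_sandwich[of "\<lambda>_. 0" "?\<mu> W \<epsilon>" sequentially
          "\<lambda>n. ?\<mu> Y \<delta> n + ?\<mu> Z \<delta> n" 0]) simp_all
qed

lemma dG_set_nonneg:
  assumes "finite (carrier G)" "isometric_action G \<phi>"
  shows "0 \<le> dG_set G \<phi> \<theta> A"
proof -
  interpret group_action G UNIV \<phi>
    using assms by (simp add: isometric_action_def)
  interpret group G
    using group_hom group_hom.axioms(1) by blast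
  \<comment> \<open>\<open>Min\<close> over the group is a genuine minimum only for a finite
    nonempty carrier.\<close>
  have "carrier G \<noteq> {}" using one_closed by blast
  then have "0 \<le> dG G \<phi> \<theta> a" for a
    using assms(1) by (simp add: dG_def)
  then show ?thesis
    unfolding dG_set_def by (intro INF_greatest) simp
qed

text \<open>Since \<open>dG\<close> does not depend on orbit representatives, both sides are infima
  of the same family; hence the two conclusions of the theorem are equivalent.\<close>

lemma orbit_dist_set_orbit:
  assumes "isometric_action G \<phi>"
  shows "orbit_dist_set G \<phi> (orbit G \<phi> \<theta>) (orbit G \<phi> ` A) = dG_set G \<phi> \<theta> A"
  by (simp add: orbit_dist_set_def dG_set_def image_image orbit_dist_orbit[OF assms])

text \<open>All maximisers share one value. This replaces the extended-real supremum in the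
  separation condition by a finite number.\<close>

lemma SUP_argmax_on:
  fixes f :: "'a \<Rightarrow> real"
  assumes "\<theta>\<^sub>0 \<in> argmax_on f K"
  shows "(SUP \<theta>\<in>argmax_on f K. ereal (f \<theta>)) = ereal (f \<theta>\<^sub>0)"
  using assms by (intro SUP_eqI) (auto simp: argmax_on_def is_arg_max_linorder)

theorem corollaryE6:
  fixes M :: "'w measure" and S :: "'x measure" and X :: "nat \<Rightarrow> 'w \<Rightarrow> 'x"
    and G :: "('g, 'm) monoid_scheme" and \<phi> :: "'g \<Rightarrow> 'a \<Rightarrow> 'a::metric_space"
    and K Q0 :: "'a set" and l :: "'a \<Rightarrow> 'x \<Rightarrow> real"
    and Qn :: "nat \<Rightarrow> 'a \<Rightarrow> 'w \<Rightarrow> real" and Q :: "'a \<Rightarrow> real"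
    and \<theta>hat :: "nat \<Rightarrow> 'w \<Rightarrow> 'a" and r :: "nat \<Rightarrow> 'w \<Rightarrow> real"
  assumes "prob_space M"
    and "iid_seq M S X"
    and "finite (carrier G)" and "isometric_action G \<phi>"
    and "K \<noteq> {}" and "compact K" and "\<forall>g\<in>carrier G. \<phi> g ` K = K"
    and "(\<lambda>(\<theta>, x). l \<theta> x) \<in> borel_measurable (borel \<Otimes>\<^sub>M S)"
    and "\<forall>\<theta>\<in>K. integrable M (\<lambda>\<omega>. l \<theta> (X 1 \<omega>))"
    and "Qn = emp_crit l X" and "Q = pop_crit M l X"
    and "\<forall>g\<in>carrier G. \<forall>\<theta>\<in>K. Q (\<phi> g \<theta>) = Q \<theta>"
    and "\<forall>g\<in>carrier G. \<forall>\<theta>\<in>K. \<forall>n\<ge>1. AE \<omega> in M. Qn n (\<phi> g \<theta>) \<omega> = Qn n \<theta> \<omega>"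
    and "Q0 = argmax_on Q K"
    and "\<forall>\<epsilon>>0. \<exists>\<eta>>0. (SUP \<theta>\<in>{\<theta>\<in>K. ereal \<epsilon> \<le> dG_set G \<phi> \<theta> Q0}. ereal (Q \<theta>))
            \<le> (SUP \<theta>\<in>Q0. ereal (Q \<theta>)) - ereal \<eta>"
    and "tendsto0_in_prob M (\<lambda>n \<omega>. SUP \<theta>\<in>K. ereal \<bar>Qn n \<theta> \<omega> - Q \<theta>\<bar>)"
    and "\<forall>n\<ge>1. \<forall>\<omega>\<in>space M. \<theta>hat n \<omega> \<in> K"
    and "\<forall>n\<ge>1. AE \<omega> in M.
            ereal (Qn n (\<theta>hat n \<omega>) \<omega>) \<ge> (SUP \<theta>\<in>K. ereal (Qn n \<theta> \<omega>)) - ereal (r n \<omega>)"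
    and "tendsto0_in_prob M (\<lambda>n \<omega>. ereal (r n \<omega>))"
  shows "tendsto0_in_prob M (\<lambda>n \<omega>. dG_set G \<phi> (\<theta>hat n \<omega>) Q0) \<and>
         tendsto0_in_prob M (\<lambda>n \<omega>. orbit_dist_set G \<phi> (orbit G \<phi> (\<theta>hat n \<omega>)) (orbit G \<phi> ` Q0))"
proof -
  have sep: "\<exists>\<eta>>0. (SUP \<theta>\<in>{\<theta>\<in>K. ereal \<epsilon> \<le> dG_set G \<phi> \<theta> Q0}. ereal (Q \<theta>))
      \<le> (SUP \<theta>\<in>Q0. ereal (Q \<theta>)) - ereal \<eta>" if "\<epsilon> > 0" for \<epsilon> :: real
    using assms(15) that by blast
  \<comment> \<open>A maximiser exists by separation: if \<open>Q0\<close> were empty, every point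
    of \<open>K\<close> would be at distance \<infinity> from it, and the condition would bound the
    supremum of \<open>Q\<close> over all of \<open>K\<close> by -\<infinity>.\<close>
  have "Q0 \<noteq> {}"
  proof
    assume "Q0 = {}"
    then obtain \<eta> :: real where "(SUP \<theta>\<in>K. ereal (Q \<theta>)) \<le> - \<infinity> - ereal \<eta>"
      using sep[of 1] by (auto simp: dG_set_def top_ereal_def bot_ereal_def)
    then show False
      using \<open>K \<noteq> {}\<close> SUP_upper[of _ K "\<lambda>\<theta>. ereal (Q \<theta>)"] by fastforce
  qed
  then obtain \<theta>\<^sub>0 where "\<theta>\<^sub>0 \<in> Q0" by blast
  then have \<theta>\<^sub>0: "\<theta>\<^sub>0 \<in> K" "(SUP \<theta>\<in>Q0. ereal (Q \<theta>)) = ereal (Q \<theta>\<^sub>0)"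
    using SUP_argmax_on[of \<theta>\<^sub>0 Q K] by (auto simp: assms(14) argmax_on_def is_arg_max_linorder)
  define D where "D n \<omega> = (SUP \<theta>\<in>K. ereal \<bar>Qn n \<theta> \<omega> - Q \<theta>\<bar>)" for n \<omega>
  have D: "tendsto0_in_prob M D"
    using assms(16) by (simp add: D_def[abs_def])
  have "tendsto0_in_prob M (\<lambda>n \<omega>. dG_set G \<phi> (\<theta>hat n \<omega>) Q0)"
  proof (rule tendsto0_in_prob_dominated[OF D assms(19)])
    fix \<epsilon> :: real assume "\<epsilon> > 0"
    then obtain \<eta> :: real where "\<eta> > 0"
      and sup: "(SUP \<theta>\<in>{\<theta>\<in>K. ereal \<epsilon> \<le> dG_set G \<phi> \<theta> Q0}. ereal (Q \<theta>)) \<le> ereal (Q \<theta>\<^sub>0) - ereal \<eta>"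
      using sep \<theta>\<^sub>0 by metis
    have gap: "Q \<theta> \<le> Q \<theta>\<^sub>0 - \<eta>" if "\<theta> \<in> K" "ereal \<epsilon> \<le> dG_set G \<phi> \<theta> Q0" for \<theta>
      using sup that by (auto simp: SUP_le_iff)
    \<comment> \<open>The fraction 1/4 works because three errors enter: the deviations at
      \<open>\<theta>hat\<close> and at \<open>\<theta>\<^sub>0\<close>, and the slack
      \<open>r\<close>. Together they cost at most 3/4 of \<eta>.\<close>
    have "AE \<omega> in M. ereal \<epsilon> < \<bar>dG_set G \<phi> (\<theta>hat n \<omega>) Q0\<bar> \<longrightarrow>
        ereal (\<eta> / 4) < \<bar>D n \<omega>\<bar> \<or> ereal (\<eta> / 4) < \<bar>ereal (r n \<omega>)\<bar>" if n: "n \<ge> 1" for n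
    proof -
      have "AE \<omega> in M. (SUP \<theta>\<in>K. ereal (Qn n \<theta> \<omega>)) - ereal (r n \<omega>) \<le> ereal (Qn n (\<theta>hat n \<omega>) \<omega>)"
        using assms(18) n by blast
      then show ?thesis
        \<comment> \<open>Membership of \<open>\<theta>hat\<close> in \<open>K\<close> is known only
          for outcomes in \<open>space M\<close>.\<close>
        using AE_space
      proof eventually_elim
        case (elim \<omega>)
        show ?case
        proof (rule impI, rule ccontr)
          assume far: "ereal \<epsilon> < \<bar>dG_set G \<phi> (\<theta>hat n \<omega>) Q0\<bar>"
            and "\<not> (ereal (\<eta> / 4) < \<bar>D n \<omega>\<bar> \<or> ereal (\<eta> / 4) < \<bar>ereal (r n \<omega>)\<bar>)"
          then have absD: "\<bar>D n \<omega>\<bar> \<le> ereal (\<eta> / 4)" and r: "\<bar>r n \<omega>\<bar> \<le> \<eta> / 4"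
            by (simp_all add: not_less)
          from absD have "D n \<omega> \<le> ereal (\<eta> / 4)"
            by (cases "D n \<omega>") simp_all
          then have dev: "\<bar>Qn n \<theta> \<omega> - Q \<theta>\<bar> \<le> \<eta> / 4" if "\<theta> \<in> K" for \<theta>
            using that by (simp add: D_def SUP_le_iff)
          have hat: "\<theta>hat n \<omega> \<in> K"
            using assms(17) n elim(2) by blast
          \<comment> \<open>Nonnegativity of the distance removes the absolute value in
            \<open>far\<close>, so the gap applies.\<close>
          then have "Q (\<theta>hat n \<omega>) \<le> Q \<theta>\<^sub>0 - \<eta>"
            using gap far dG_set_nonneg[OF assms(3,4)] by (simp add: abs_ereal_pos)
          \<comment> \<open>The empirical supremum is used only through its value at the competitor
            \<open>\<theta>\<^sub>0\<close>, which makes the inequality one between reals.\<close>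
          moreover have "ereal (Qn n \<theta>\<^sub>0 \<omega>) - ereal (r n \<omega>) \<le> ereal (Qn n (\<theta>hat n \<omega>) \<omega>)"
            using elim(1) \<theta>\<^sub>0 by (meson SUP_upper ereal_minus_mono order_refl order_trans)
          \<comment> \<open>Passing from \<open>Q\<close> to \<open>Qn\<close> at
            \<open>\<theta>hat\<close>, then to \<open>\<theta>\<^sub>0\<close>, then back to
            \<open>Q\<close> gives \<open>Q (\<theta>hat n \<omega>) \<ge> Q \<theta>\<^sub>0 - 3 *
            \<eta> / 4\<close>, against the gap \<eta>.\<close>
          ultimately show False
            using dev[OF hat] dev[OF \<theta>\<^sub>0(1)] r \<open>\<eta> > 0\<close> by (simp add: abs_le_iff)
        qed
      qed
    qed
    then show "\<exists>\<delta>>0. \<forall>n\<ge>1. AE \<omega> in M. ereal \<epsilon> < \<bar>dG_set G \<phi> (\<theta>hat n \<omega>) Q0\<bar> \<longrightarrow>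
        ereal \<delta> < \<bar>D n \<omega>\<bar> \<or> ereal \<delta> < \<bar>ereal (r n \<omega>)\<bar>"
      using \<open>\<eta> > 0\<close> by (intro exI[of _ "\<eta> / 4"]) simp
  qed
  then show ?thesis
    by (simp add: orbit_dist_set_orbit[OF assms(4)])
qed

end
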